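(* Fix $c\in(1/5,1/3)$ and let $s=-\log 3/\log c<1$. For a given set of translations $\mathbf{t}=(t_1,t_2,t_3)\in\mathbb{R}^3$, let $F_{\mathbf{t}}\subset\mathbb{R}$ denote the self-similar attractor of the IFS $\{x\mapsto cx+t_i\}_{i=1}^3$ on $\mathbb{R}$. Then there exist two non-empty disjoint open sets $U,V\subseteq\mathbb{R}^3$ such that $$\dim_{\mathrm{A}}F_{\mathbf{t}}=s\quad\text{for all }\mathbf{t}\in U,\qquad \dim_{\mathrm{A}}F_{\mathbf{t}}=1\quad\text{for Lebesgue almost all }\mathbf{t}\in V.$$ In particular, $\mathbf{t}\mapsto\dim_{\mathrm{A}}F_{\mathbf{t}}$ is not an almost surely constant function.
   Context: The attractor $F_{\mathbf{t}}$ is the unique non-empty compact set with $F_{\mathbf{t}}=\bigcup_{i=1}^3(cF_{\mathbf{t}}+t_i)$. For a non-empty set $E$ and $r>0$, $N_r(E)$ is the smallest number of open sets of diameter at most $r$ needed to cover $E$. The Assouad dimension of a non-empty set $F\subseteq\mathbb{R}^d$ is $$\dim_{\mathrm{A}}F=\inf\Big\{s\ge 0:\ (\exists C>0)(\forall R>0)(\forall r\in(0,R))(\forall x\in F)\ N_r(B(x,R)\cap F)\le C\Big(\frac{R}{r}\Big)^s\Big\},$$ where $B(x,R)$ is the open Euclidean ball. *)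

theory Defs
  imports "HOL-Analysis.Analysis"
begin

text \<open>The boundedness requirement is needed because the library's \<open>diameter\<close> is not
  meaningful on unbounded sets (for which the diameter is infinite). The value is the intended
  one whenever a finite cover exists, in particular for every bounded \<open>E\<close>, which is the only case
  used below.\<close>

definition covering_number :: "real \<Rightarrow> 'a::euclidean_space set \<Rightarrow> nat" where
  "covering_number r E =
     (LEAST n. \<exists>\<U>. finite \<U> \<and> card \<U> = n \<and>
        (\<forall>U\<in>\<U>. open U \<and> bounded U \<and> diameter U \<le> r) \<and> E \<subseteq> \<Union>\<U>)"

text \<open>The infimum is over a set that is bounded below by 0 and nonempty (it contains the ambient
  dimension), so the infimum of the reals is the intended one.\<close>

definition assouad_dim :: "'a::euclidean_space set \<Rightarrow> real" where
  "assouad_dim F =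
     Inf {s. s \<ge> 0 \<and> (\<exists>C>0. \<forall>R>0. \<forall>r\<in>{0<..<R}. \<forall>x\<in>F.
        real (covering_number r (ball x R \<inter> F)) \<le> C * (R / r) powr s)}"

text \<open>For \<open>0 < c < 1\<close> the attractor exists and is unique by Hutchinson's theorem; the index
  \<open>i\<close> ranges over the three-element type \<open>3\<close>.\<close>

definition attractor :: "real \<Rightarrow> real ^ 3 \<Rightarrow> real set" where
  "attractor c t =
     (THE F. F \<noteq> {} \<and> compact F \<and> F = (\<Union>i. (\<lambda>x. c * x + t $ i) ` F))"

end

theory Submission
  imports Defs
begin

text \<open>
  Write \<open>a = t\<^sub>2 - t\<^sub>1\<close>, \<open>w = t\<^sub>3 - t\<^sub>1\<close> and let \<open>h = w / (1 - c)\<close>, the diameter of the attractor when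
  \<open>t\<^sub>1 \<le> t\<^sub>2 \<le> t\<^sub>3\<close>. The first-level pieces then sit in intervals of length \<open>c h\<close>, so the sign of \<open>a - c h\<close>
  decides whether the first two of these intervals overlap.

  On \<open>U\<close> (\<open>separation_region\<close>) all three intervals are disjoint. Pieces of level \<open>n\<close> are then separated
  on the scale \<open>c\<^sup>n\<close>, and counting them gives the Assouad dimension \<open>s\<close> (\<open>assouad_dim_separated\<close>).

  On \<open>V\<close> (\<open>overlap_region\<close>) the first two intervals overlap, but \<open>a\<close> is so large that the
  seven differences \<open>t\<^sub>i - t\<^sub>j\<close>, fattened by \<open>c h\<close>, cover \<open>[-h, h]\<close>; such an \<open>a\<close> exists exactly when
  \<open>c > 1/5\<close>. Hence the difference set of the attractor is the whole interval \<open>[-h, h]\<close>, and for each \<open>n\<close>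
  there are two words of length \<open>n\<close>, starting with 2 and 1, whose images of the origin are
  within \<open>h c\<^sup>n\<close> of each other. As \<open>t\<^sub>2\<close> varies, the displacement between these images moves with
  speed at least 1/2, because the first letters contribute 1 and all later ones at most
  \<open>c / (1 - c) < 1/2\<close>. So within distance of order \<open>c\<^sup>n\<close> of every \<open>t\<close> in \<open>V\<close> there is a ball of radius
  comparable to \<open>\<epsilon> c\<^sup>n\<close> on which the displacement lies strictly between \<open>0\<close> and \<open>\<epsilon> c\<^sup>n\<close>
  (\<open>overlap_region_holes\<close>). The parameters that admit no such near coincidence thus form a porous
  set, and porous sets are null (\<open>porous_imp_negligible\<close>).

  If nonzero displacements that are arbitrarily small relative to \<open>c\<^sup>n\<close> occur, they can be chained:
  prolonging both words by common letters rescales a displacement until it matches the scale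
  already reached, and each chaining adds one point. In this way the attractor contains arbitrarily
  long progressions with comparable consecutive gaps (\<open>near_coincidences_progression\<close>), and these force
  Assouad dimension at least 1 (\<open>assouad_exponent_near_coincidences\<close>).
\<close>

section \<open>Porous sets are null sets\<close>

text \<open>
  Cover almost all of \<open>S\<close> by disjoint Vitali balls inside an open set \<open>T\<close> that exceeds \<open>S\<close> by little.
  Their holes are disjoint subsets of \<open>T - S\<close>, hence have small total measure, and each ball is larger
  than its hole by the same factor \<open>M\<close>.
\<close>
lemma porous_imp_negligible:
  fixes S :: "'a::euclidean_space set"
  assumes S: "S \<in> sets lebesgue" and "0 < \<kappa>"
    and porous: "\<And>x e. x \<in> S \<Longrightarrow> 0 < e \<Longrightarrow>
      \<exists>d y. 0 < d \<and> d < e \<and> ball y (\<kappa> * d) \<subseteq> ball x d - S"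
  shows "negligible S"
proof -
  let ?\<mu> = "emeasure lebesgue :: 'a set \<Rightarrow> ennreal"
  define M where "M = (1 / \<kappa>) ^ DIM('a)"
  have "M > 0" using \<open>0 < \<kappa>\<close> by (simp add: M_def)
  have scale: "?\<mu> (ball x d) = ennreal M * ?\<mu> (ball y (\<kappa> * d))" if "d > 0" for x y :: 'a and d
  proof -
    have "M * (unit_ball_vol (DIM('a)) * (\<kappa> * d) ^ DIM('a)) = unit_ball_vol (DIM('a)) * d ^ DIM('a)"
      using \<open>0 < \<kappa>\<close> by (simp add: M_def power_mult_distrib power_one_over)
    moreover have "0 \<le> unit_ball_vol (DIM('a)) * (\<kappa> * d) ^ DIM('a)"
      using \<open>0 < \<kappa>\<close> that by simp
    ultimately show ?thesis
      using \<open>0 < \<kappa>\<close> that \<open>M > 0\<close>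
      by (auto simp: emeasure_ball ennreal_mult [symmetric])
  qed
  have le: "?\<mu> S \<le> ennreal (M * \<eta>)" if "\<eta> > 0" for \<eta>
  proof -
    obtain T where T: "open T" "S \<subseteq> T" "T - S \<in> lmeasurable" "?\<mu> (T - S) < ennreal \<eta>"
      using sets_lebesgue_outer_open [OF S \<open>\<eta> > 0\<close>] by blast
    define B where "B i = ball (fst i) (fst (snd i))" for i :: "'a \<times> real \<times> 'a"
    define H where "H i = ball (snd (snd i)) (\<kappa> * fst (snd i))" for i :: "'a \<times> real \<times> 'a"
    define K where "K = {i. 0 < fst (snd i) \<and> B i \<subseteq> T \<and> H i \<subseteq> B i - S}"
    have "\<exists>i. i \<in> K \<and> x \<in> ball (fst i) (fst (snd i)) \<and> fst (snd i) < e" if "x \<in> S" "0 < e" for x e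
    proof -
      obtain \<rho> where "\<rho> > 0" "ball x \<rho> \<subseteq> T"
        using T \<open>x \<in> S\<close> open_contains_ball by blast
      obtain d y where d: "0 < d" "d < min e \<rho>" "ball y (\<kappa> * d) \<subseteq> ball x d - S"
        using porous [OF \<open>x \<in> S\<close>, of "min e \<rho>"] \<open>0 < e\<close> \<open>0 < \<rho>\<close> by auto
      have "ball x d \<subseteq> T"
        using d \<open>ball x \<rho> \<subseteq> T\<close> by (auto intro: subset_trans [OF subset_ball])
      then have "(x, d, y) \<in> K" using d by (auto simp: K_def B_def H_def)
      then show ?thesis using d by force
    qed
    then obtain C where C: "countable C" "C \<subseteq> K"
      and disj: "pairwise (\<lambda>i j. disjnt (B i) (B j)) C"
      and neg: "negligible (S - (\<Union>i\<in>C. B i))"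
      using Vitali_covering_theorem_balls [of S K fst "\<lambda>i. fst (snd i)"] unfolding B_def by blast
    have HB: "H i \<subseteq> B i - S" "B i \<subseteq> T" if "i \<in> C" for i
      using C that by (auto simp: K_def)
    have disjH: "disjoint_family_on H C"
      using disj HB unfolding disjoint_family_on_def pairwise_def disjnt_def by blast
    have BC: "(\<Union>i\<in>C. B i) \<in> sets lebesgue"
      by (intro sets_completionI_sets) (auto simp: B_def intro!: borel_open)
    have "?\<mu> S \<le> ?\<mu> ((\<Union>i\<in>C. B i) \<union> (S - (\<Union>i\<in>C. B i)))"
      using S BC by (intro emeasure_mono) auto
    also have "\<dots> = ?\<mu> (\<Union>i\<in>C. B i)"
      using neg BC by (intro emeasure_Un_null_set) (auto simp: negligible_iff_null_sets)
    also have "\<dots> = (\<integral>\<^sup>+i. ?\<mu> (B i) \<partial>count_space C)"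
      using C disj by (intro emeasure_UN_countable)
        (auto simp: B_def disjoint_family_on_def pairwise_def disjnt_def)
    also have "\<dots> = (\<integral>\<^sup>+i. ennreal M * ?\<mu> (H i) \<partial>count_space C)"
      using C by (intro nn_integral_cong) (auto simp: B_def H_def K_def simp del: emeasure_completion intro!: scale)
    also have "\<dots> = ennreal M * (\<integral>\<^sup>+i. ?\<mu> (H i) \<partial>count_space C)"
      by (simp add: nn_integral_cmult)
    also have "(\<integral>\<^sup>+i. ?\<mu> (H i) \<partial>count_space C) = ?\<mu> (\<Union>i\<in>C. H i)"
      by (rule emeasure_UN_countable [OF _ C(1) disjH, symmetric]) (simp add: H_def)
    also have "?\<mu> (\<Union>i\<in>C. H i) \<le> ?\<mu> (T - S)"
      using HB T(3) by (intro emeasure_mono) (blast, auto)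
    also have "?\<mu> (T - S) \<le> ennreal \<eta>" using T by simp
    finally show ?thesis
      using \<open>M > 0\<close> \<open>\<eta> > 0\<close> by (simp add: ennreal_mult mult_left_mono)
  qed
  have "?\<mu> S \<le> 0"
  proof (rule ennreal_le_epsilon)
    fix e :: real assume "0 < e"
    with le [of "e / M"] \<open>M > 0\<close> show "?\<mu> S \<le> 0 + ennreal e" by simp
  qed
  then show ?thesis
    using S by (simp add: negligible_iff_null_sets null_sets_def)
qed

section \<open>Covering numbers and the Assouad dimension\<close>

definition open_cover :: "real \<Rightarrow> 'a::euclidean_space set \<Rightarrow> 'a set set \<Rightarrow> bool" where
  "open_cover r E \<U> \<longleftrightarrow>
     finite \<U> \<and> (\<forall>U\<in>\<U>. open U \<and> bounded U \<and> diameter U \<le> r) \<and> E \<subseteq> \<Union>\<U>"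

lemma covering_number_le:
  assumes "open_cover r E \<U>"
  shows "covering_number r E \<le> card \<U>"
  unfolding covering_number_def using assms unfolding open_cover_def
  by (intro Least_le exI [of _ \<U>]) auto

lemma covering_number_attained:
  assumes "open_cover r E \<U>"
  obtains \<V> where "open_cover r E \<V>" "card \<V> = covering_number r E"
proof -
  let ?P = "\<lambda>n. \<exists>\<U>. finite \<U> \<and> card \<U> = n \<and>
        (\<forall>U\<in>\<U>. open U \<and> bounded U \<and> diameter U \<le> r) \<and> E \<subseteq> \<Union>\<U>"
  have "?P (card \<U>)" using assms unfolding open_cover_def by blast
  then have "?P (Least ?P)" by (rule LeastI)
  then show thesis
    using that unfolding open_cover_def covering_number_def by blast
qed

lemma bounded_imp_open_cover:
  fixes E :: "'a::euclidean_space set"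
  assumes "bounded E" "0 < r"
  obtains \<U> where "open_cover r E \<U>"
proof -
  have "compact (closure E)" using assms by simp
  moreover have "closure E \<subseteq> (\<Union>x\<in>UNIV. ball x (r / 2))"
    using assms centre_in_ball half_gt_zero by blast
  ultimately obtain X where X: "finite X" "closure E \<subseteq> (\<Union>x\<in>X. ball x (r / 2))"
    using compactE_image [of "closure E" UNIV "\<lambda>x. ball x (r / 2)"] by (metis open_ball)
  have "E \<subseteq> (\<Union>x\<in>X. ball x (r / 2))"
    using X closure_subset by blast
  then have "open_cover r E ((\<lambda>x. ball x (r / 2)) ` X)"
    using assms X by (auto simp: open_cover_def)
  then show thesis by (rule that)
qed

text \<open>
  A set of diameter at most \<open>r\<close> contains at most one point of \<open>P\<close>.
\<close>
lemma card_separated_le_covering_number: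
  fixes E P :: "'a::euclidean_space set"
  assumes "bounded E" "0 < r" "P \<subseteq> E"
    and sep: "\<And>x y. x \<in> P \<Longrightarrow> y \<in> P \<Longrightarrow> x \<noteq> y \<Longrightarrow> r < dist x y"
  shows "card P \<le> covering_number r E"
proof -
  obtain \<V> where \<V>: "open_cover r E \<V>" "card \<V> = covering_number r E"
    using bounded_imp_open_cover covering_number_attained assms by metis
  have "\<forall>x\<in>P. \<exists>V\<in>\<V>. x \<in> V" using \<V> assms unfolding open_cover_def by blast
  then obtain f where f: "\<And>x. x \<in> P \<Longrightarrow> f x \<in> \<V> \<and> x \<in> f x" by metis
  have "inj_on f P"
  proof (rule inj_onI, rule ccontr)
    fix x y assume xy: "x \<in> P" "y \<in> P" "f x = f y" "x \<noteq> y"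
    then have "dist x y \<le> diameter (f x)"
      using f [of x] f [of y] \<V> unfolding open_cover_def by (intro diameter_bounded_bound) auto
    also have "\<dots> \<le> r" using f xy \<V> unfolding open_cover_def by auto
    finally show False using sep xy by force
  qed
  then show ?thesis
    using f \<V> card_inj_on_le [of f P \<V>] unfolding open_cover_def by auto
qed

definition assouad_exponent :: "'a::euclidean_space set \<Rightarrow> real \<Rightarrow> bool" where
  "assouad_exponent F s \<longleftrightarrow> s \<ge> 0 \<and> (\<exists>C>0. \<forall>R>0. \<forall>r\<in>{0<..<R}. \<forall>x\<in>F.
        real (covering_number r (ball x R \<inter> F)) \<le> C * (R / r) powr s)"

lemma assouad_dim_eq: "assouad_dim F = Inf (Collect (assouad_exponent F))"
  by (simp add: assouad_dim_def assouad_exponent_def [abs_def])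

lemma assouad_dim_le:
  assumes "assouad_exponent F s"
  shows "assouad_dim F \<le> s"
  unfolding assouad_dim_eq
  by (rule cInf_lower) (use assms in \<open>auto simp: assouad_exponent_def intro!: bdd_belowI [of _ 0]\<close>)

text \<open>
  An interval of radius \<open>R\<close> is covered by about \<open>4 R / r\<close> intervals of length \<open>r\<close> whose centres are
  \<open>r / 2\<close> apart.
\<close>
lemma assouad_exponent_1:
  fixes F :: "real set"
  shows "assouad_exponent F 1"
  unfolding assouad_exponent_def
proof (intro conjI exI [of _ 6] allI impI ballI)
  fix R r x :: real
  assume "0 < R" "r \<in> {0<..<R}" "x \<in> F"
  then have r: "0 < r" "r < R" by auto
  define J where "J k = ball (x - R + real k * (r / 2)) (r / 2)" for k :: nat
  define n where "n = nat \<lceil>4 * R / r\<rceil>"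
  have "open_cover r (ball x R \<inter> F) (J ` {..n})"
    unfolding open_cover_def
  proof (intro conjI ballI subsetI)
    fix U assume "U \<in> J ` {..n}"
    then obtain k where U: "U = J k" by blast
    show "open U" "bounded U" by (auto simp: U J_def)
    show "diameter U \<le> r" using r by (auto simp: U J_def)
  next
    fix y assume "y \<in> ball x R \<inter> F"
    then have y: "x - R < y" "y < x + R" by (auto simp: dist_real_def)
    define z where "z = (y - (x - R)) / (r / 2)"
    have z: "y = x - R + z * (r / 2)" "0 < z"
      using r y by (auto simp: z_def field_simps)
    have "z < 2 * R / (r / 2)"
      unfolding z_def using r y by (intro divide_strict_right_mono) auto
    then have "z < 4 * R / r" by simp
    define k where "k = nat \<lfloor>z\<rfloor>"
    have k: "real k \<le> z" "z < real k + 1"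
      using z by (auto simp: k_def)
    then have "real k < 4 * R / r" using \<open>z < 4 * R / r\<close> by simp
    then have "k \<le> n" unfolding n_def by linarith
    moreover have "y \<in> J k"
    proof -
      have "real k * (r / 2) \<le> z * (r / 2)" "z * (r / 2) < (real k + 1) * (r / 2)"
        using k r by (simp_all add: mult_right_mono)
      then show ?thesis
        unfolding J_def mem_ball dist_real_def z(1) by (simp add: algebra_simps)
    qed
    ultimately show "y \<in> \<Union> (J ` {..n})" by blast
  qed auto
  then have "covering_number r (ball x R \<inter> F) \<le> card (J ` {..n})" by (rule covering_number_le)
  also have "\<dots> \<le> Suc n" using card_image_le [of "{..n}" J] by simp
  finally have "real (covering_number r (ball x R \<inter> F)) \<le> 1 + real n" by simp
  also have "\<dots> \<le> 6 * (R / r)"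
  proof -
    have "real n \<le> 4 * R / r + 1" using r unfolding n_def by simp
    moreover have "R / r > 1" using r by simp
    ultimately show ?thesis by simp
  qed
  finally show "real (covering_number r (ball x R \<inter> F)) \<le> 6 * (R / r) powr 1"
    using r by simp
qed auto

text \<open>
  The infimum of the empty set of reals is unspecified, so the bound needs some exponent to exist;
  in the line, 1 is always one.
\<close>
lemma assouad_dim_ge:
  fixes F :: "real set"
  assumes "\<And>s. assouad_exponent F s \<Longrightarrow> a \<le> s"
  shows "a \<le> assouad_dim F"
  unfolding assouad_dim_eq
  by (rule cInf_greatest) (use assms assouad_exponent_1 in auto)

section \<open>Words and the attractor\<close>

text \<open>
  The image of the origin under the composition of the maps \<open>x \<mapsto> c x + t\<^sub>i\<close> along the word. The whole
  composition is \<open>x \<mapsto> word_point c t w + c ^ length w * x\<close>.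
\<close>
fun word_point :: "real \<Rightarrow> real ^ 'n \<Rightarrow> 'n::finite list \<Rightarrow> real" where
  "word_point c t [] = 0"
| "word_point c t (i # w) = t $ i + c * word_point c t w"

lemma word_point_append:
  "word_point c t (u @ v) = word_point c t u + c ^ length u * word_point c t v"
  by (induction u) (auto simp: algebra_simps)

text \<open>
  For a fixed word the point is linear in the translations. This makes the displacement between two
  words an affine function along every line of parameters.
\<close>
lemma word_point_add_scaleR:
  "word_point c (t + x *\<^sub>R e) w = word_point c t w + x * word_point c e w"
  by (induction w) (auto simp: algebra_simps)

lemma abs_word_point_le:
  assumes "0 \<le> c" "c < 1"
  shows "\<bar>word_point c t w\<bar> \<le> norm t / (1 - c)"
proof (induction w)
  case (Cons i w)
  have "\<bar>word_point c t (i # w)\<bar> \<le> \<bar>t $ i\<bar> + c * \<bar>word_point c t w\<bar>"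
    using abs_triangle_ineq [of "t $ i" "c * word_point c t w"] assms by (simp add: abs_mult)
  also have "\<dots> \<le> norm t + c * (norm t / (1 - c))"
    using component_le_norm_cart [of t i] Cons assms by (intro add_mono mult_left_mono) auto
  also have "\<dots> = norm t / (1 - c)" using assms by (simp add: field_simps)
  finally show ?case .
qed (use assms in auto)

definition is_attractor :: "real \<Rightarrow> real ^ 'n::finite \<Rightarrow> real set \<Rightarrow> bool" where
  "is_attractor c t F \<longleftrightarrow> F \<noteq> {} \<and> compact F \<and> F = (\<Union>i. (\<lambda>x. c * x + t $ i) ` F)"

lemma is_attractor_word_point_in:
  assumes "is_attractor c t F" "x \<in> F"
  shows "word_point c t w + c ^ length w * x \<in> F"
proof (induction w)
  case (Cons i w)
  then have "c * (word_point c t w + c ^ length w * x) + t $ i \<in> F"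
    using assms unfolding is_attractor_def by blast
  then show ?case by (simp add: algebra_simps)
qed (use assms in auto)

lemma is_attractor_expansion:
  assumes "is_attractor c t F" "x \<in> F"
  obtains w y where "length w = n" "y \<in> F" "x = word_point c t w + c ^ n * y"
proof -
  have "\<exists>w y. length w = n \<and> y \<in> F \<and> x = word_point c t w + c ^ n * y"
    using assms(2)
  proof (induction n arbitrary: x)
    case (Suc n)
    then obtain i x' where x': "x' \<in> F" "x = c * x' + t $ i"
      using assms(1) unfolding is_attractor_def by blast
    then obtain w y where "length w = n" "y \<in> F" "x' = word_point c t w + c ^ n * y"
      using Suc.IH by blast
    then have "length (i # w) = Suc n \<and> y \<in> F \<and> x = word_point c t (i # w) + c ^ Suc n * y"
      using x' by (simp add: algebra_simps)
    then show ?case by blast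
  qed auto
  then show thesis using that by blast
qed

text \<open>
  Both sets are invariant, so the word that leads to \<open>x\<close> from a point of \<open>F\<close> leads from a point of \<open>G\<close> to
  one within \<open>c\<^sup>n D\<close> of \<open>x\<close>.
\<close>
lemma is_attractor_subset:
  assumes "0 < c" "c < 1" and F: "is_attractor c t F" and G: "is_attractor c t G"
  shows "F \<subseteq> G"
proof
  fix x assume "x \<in> F"
  obtain g where "g \<in> G" using G by (auto simp: is_attractor_def)
  have "bounded F" using F by (auto simp: is_attractor_def compact_imp_bounded)
  then obtain D0 where "\<And>y. y \<in> F \<Longrightarrow> dist g y \<le> D0"
    using bounded_any_center by blast
  then have D: "\<And>y. y \<in> F \<Longrightarrow> dist g y \<le> max D0 1" "0 < max D0 1"
    by (simp_all add: le_max_iff_disj)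
  define D where "D = max D0 1"
  note D = D [folded D_def]
  have "x \<in> closure G"
    unfolding closure_approachable
  proof (intro allI impI)
    fix e :: real assume "0 < e"
    obtain n where n: "c ^ n < e / D"
      using real_arch_pow_inv [of "e / D" c] \<open>c < 1\<close> \<open>0 < e\<close> \<open>0 < D\<close> by auto
    obtain w y where w: "length w = n" "y \<in> F" "x = word_point c t w + c ^ n * y"
      using is_attractor_expansion [OF F \<open>x \<in> F\<close>] .
    define z where "z = word_point c t w + c ^ n * g"
    have "z \<in> G"
      using is_attractor_word_point_in [OF G \<open>g \<in> G\<close>] w(1) by (auto simp: z_def)
    have "dist z x = \<bar>c ^ n * (g - y)\<bar>" by (simp add: z_def w dist_real_def algebra_simps)
    also have "\<dots> = c ^ n * dist g y" using \<open>0 < c\<close> by (simp add: abs_mult dist_real_def)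
    also have "\<dots> \<le> c ^ n * D" using D w \<open>0 < c\<close> by (intro mult_left_mono) auto
    also have "\<dots> < e" using n D by (simp add: field_simps)
    finally show "\<exists>z\<in>G. dist z x < e" using \<open>z \<in> G\<close> by blast
  qed
  then show "x \<in> G" using G by (auto simp: is_attractor_def compact_imp_closed)
qed

text \<open>
  The attractor is the intersection of the nested compact sets \<open>K n\<close>, the images of \<open>[-M, M]\<close> under all
  words of length \<open>n\<close>; \<open>M\<close> is chosen so that each map sends \<open>[-M, M]\<close> into itself.
\<close>
lemma is_attractor_exists:
  fixes t :: "real ^ 'n::finite"
  assumes "0 < c" "c < 1"
  obtains F where "is_attractor c t F"
proof -
  define M where "M = norm t / (1 - c)"
  have M: "0 \<le> M" "\<And>i. \<bar>t $ i\<bar> \<le> (1 - c) * M"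
    using assms component_le_norm_cart [of t] by (auto simp: M_def)
  define K where "K n = (\<Union>w\<in>{w. length w = n}. cball (word_point c t w) (c ^ n * M))" for n
  have memK: "x \<in> K n \<longleftrightarrow> (\<exists>w. length w = n \<and> \<bar>x - word_point c t w\<bar> \<le> c ^ n * M)" for x n
    by (auto simp: K_def dist_real_def abs_minus_commute)
  have "compact (K n)" for n
  proof -
    have "finite {w :: 'n list. length w = n}"
      using finite_lists_length_eq [of "UNIV :: 'n set" n] by simp
    then show ?thesis unfolding K_def by (intro compact_UN) auto
  qed
  moreover have "K n \<noteq> {}" for n
  proof -
    have "word_point c t (replicate n undefined) \<in> K n"
      unfolding memK using M assms by (intro exI [of _ "replicate n undefined"]) auto
    then show ?thesis by blast
  qed
  moreover have KSuc: "K (Suc n) \<subseteq> K n" for n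
  proof
    fix x assume "x \<in> K (Suc n)"
    then obtain w where w: "length w = Suc n" "\<bar>x - word_point c t w\<bar> \<le> c ^ Suc n * M"
      unfolding memK by blast
    then obtain u i where ui: "w = u @ [i]" "length u = n"
      by (metis length_Suc_conv_rev)
    have "\<bar>c ^ n * t $ i\<bar> \<le> c ^ n * ((1 - c) * M)"
      using M(2) [of i] assms by (simp add: abs_mult)
    moreover have "word_point c t w = word_point c t u + c ^ n * t $ i"
      using ui by (simp add: word_point_append)
    ultimately have "\<bar>x - word_point c t u\<bar> \<le> c ^ n * M"
      using w by (simp add: algebra_simps)
    then show "x \<in> K n" unfolding memK using ui by blast
  qed
  moreover have antimono: "K n \<subseteq> K m" if "m \<le> n" for m n
    using KSuc that by (rule lift_Suc_antimono_le)
  ultimately have "\<Inter> (range K) \<noteq> {}"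
    by (intro compact_nest) auto
  have shift: "c * y + t $ i \<in> K (Suc n)" if y: "y \<in> K n" for y i n
  proof -
    obtain w where w: "length w = n" "\<bar>y - word_point c t w\<bar> \<le> c ^ n * M"
      using y unfolding memK by blast
    have "c * y + t $ i - word_point c t (i # w) = c * (y - word_point c t w)"
      by (simp add: algebra_simps)
    then have "\<bar>c * y + t $ i - word_point c t (i # w)\<bar> = c * \<bar>y - word_point c t w\<bar>"
      using assms by (simp add: abs_mult)
    also have "\<dots> \<le> c ^ Suc n * M" using w assms by simp
    finally show ?thesis unfolding memK using w by (metis length_Cons)
  qed
  have unshift: "\<exists>i y. y \<in> K n \<and> x = c * y + t $ i" if x: "x \<in> K (Suc n)" for x n
  proof -
    obtain i w where w: "length w = n" "\<bar>x - word_point c t (i # w)\<bar> \<le> c ^ Suc n * M"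
      using x unfolding memK length_Suc_conv by blast
    define y where "y = (x - t $ i) / c"
    have y: "x = c * y + t $ i" using assms by (simp add: y_def)
    then have "x - word_point c t (i # w) = c * (y - word_point c t w)"
      by (simp add: algebra_simps)
    then have "c * \<bar>y - word_point c t w\<bar> \<le> c * (c ^ n * M)"
      using w assms by (simp add: abs_mult)
    then have "y \<in> K n" unfolding memK using w assms by auto
    then show ?thesis using y by blast
  qed
  define F where "F = \<Inter> (range K)"
  have "is_attractor c t F"
    unfolding is_attractor_def
  proof (intro conjI set_eqI iffI)
    show "F \<noteq> {}" using \<open>\<Inter> (range K) \<noteq> {}\<close> by (simp add: F_def)
    show "compact F"
      unfolding F_def using \<open>\<And>n. compact (K n)\<close> by (intro compact_Inter) auto
  next
    fix x assume "x \<in> F"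
    show "x \<in> (\<Union>i. (\<lambda>x. c * x + t $ i) ` F)"
      \<comment> \<open>If each preimage of \<open>x\<close> misses some \<open>K n\<close>, then all of them miss one common \<open>K n\<close>,
        because there are finitely many and the \<open>K n\<close> are nested.\<close>
    proof (rule ccontr)
      assume "x \<notin> (\<Union>i. (\<lambda>x. c * x + t $ i) ` F)"
      moreover have "x = c * ((x - t $ i) / c) + t $ i" for i using assms by simp
      ultimately have "\<forall>i. (x - t $ i) / c \<notin> F" by blast
      then have "\<forall>i. \<exists>n. (x - t $ i) / c \<notin> K n"
        unfolding F_def by blast
      then obtain N where N: "\<And>i. (x - t $ i) / c \<notin> K (N i)"
        by metis
      obtain i y where iy: "y \<in> K (Max (range N))" "x = c * y + t $ i"
        using unshift \<open>x \<in> F\<close> unfolding F_def by blast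
      then have "y \<in> K (N i)" using antimono [of "N i" "Max (range N)"] by auto
      moreover have "y = (x - t $ i) / c" using iy assms by simp
      ultimately show False using N by blast
    qed
  next
    fix x assume "x \<in> (\<Union>i. (\<lambda>x. c * x + t $ i) ` F)"
    then obtain i y where "y \<in> F" "x = c * y + t $ i" by blast
    then have "x \<in> K (Suc n)" for n using shift unfolding F_def by blast
    then show "x \<in> F" using KSuc unfolding F_def by blast
  qed
  then show thesis by (rule that)
qed

lemma is_attractor_attractor:
  assumes "0 < c" "c < 1"
  shows "is_attractor c t (attractor c t)"
proof -
  obtain F where F: "is_attractor c t F" using is_attractor_exists assms by blast
  have "attractor c t = (THE F. is_attractor c t F)"
    by (simp add: attractor_def is_attractor_def)
  also have "\<dots> = F"
    using F is_attractor_subset [OF assms] by (intro the_equality) (auto intro: subset_antisym)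
  finally show ?thesis using F by simp
qed

section \<open>Separated first-level pieces\<close>

definition separated_pieces :: "real \<Rightarrow> real ^ 'n::finite \<Rightarrow> real \<Rightarrow> real set \<Rightarrow> bool" where
  "separated_pieces c t g F \<longleftrightarrow>
     (\<forall>i j. \<forall>x\<in>F. \<forall>y\<in>F. i \<noteq> j \<longrightarrow> g \<le> \<bar>(c * x + t $ i) - (c * y + t $ j)\<bar>)"

text \<open>
  At the first letter where the words differ, say at position \<open>k < n\<close>, the separation of the
  first-level pieces gives the gap \<open>c\<^sup>k g\<close>.
\<close>
lemma separated_word_pieces:
  assumes F: "is_attractor c t F" and sep: "separated_pieces c t g F"
    and c: "0 < c" "c < 1" "0 < g"
    and "length w = n" "length v = n" "w \<noteq> v" "x \<in> F" "y \<in> F"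
  shows "c ^ n * g < \<bar>(word_point c t w + c ^ n * x) - (word_point c t v + c ^ n * y)\<bar>"
  using assms(6-8)
proof (induction n arbitrary: w v)
  case (Suc n)
  obtain i w' j v' where wv: "w = i # w'" "v = j # v'" "length w' = n" "length v' = n"
    using Suc.prems by (metis length_Suc_conv)
  let ?x = "word_point c t w' + c ^ n * x" and ?y = "word_point c t v' + c ^ n * y"
  have diff: "(word_point c t w + c ^ Suc n * x) - (word_point c t v + c ^ Suc n * y)
      = (c * ?x + t $ i) - (c * ?y + t $ j)"
    by (simp add: wv algebra_simps)
  show ?case
  proof (cases "i = j")
    case True
    then have "c ^ n * g < \<bar>?x - ?y\<bar>" using Suc.IH Suc.prems wv by auto
    then have "c * (c ^ n * g) < c * \<bar>?x - ?y\<bar>" using c by simp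
    also have "\<dots> = \<bar>c * (?x - ?y)\<bar>" using c by (simp add: abs_mult)
    also have "c * (?x - ?y) = (c * ?x + t $ i) - (c * ?y + t $ j)"
      using True by (simp add: algebra_simps)
    finally show ?thesis unfolding diff by simp
  next
    case False
    have "?x \<in> F" "?y \<in> F"
      using is_attractor_word_point_in [OF F] assms wv by metis+
    then have "g \<le> \<bar>(c * ?x + t $ i) - (c * ?y + t $ j)\<bar>"
      using sep False unfolding separated_pieces_def by blast
    moreover have "c ^ Suc n * g < g"
      using c power_Suc_less_one [of c n] by (simp del: power_Suc)
    ultimately show ?thesis unfolding diff by linarith
  qed
qed simp

lemma card_words: "card {w :: 'n::finite list. length w = n} = CARD('n) ^ n"
  using card_lists_length_eq [of "UNIV :: 'n set" n] by simp

lemma finite_words: "finite {w :: 'n::finite list. length w = n}"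
  using finite_lists_length_eq [of "UNIV :: 'n set" n] by simp

text \<open>
  A ball of radius \<open>R \<le> c\<^sup>m g\<close> centred in \<open>F\<close> meets a single piece of level \<open>m\<close>, which
  consists of \<open>CARD('n) ^ (n - m)\<close> pieces of level \<open>n\<close>, each of size at most \<open>r / 2\<close>. At level \<open>0\<close> there is only one piece, so no bound on
  \<open>R\<close> is imposed there; this covers the radii larger than \<open>g\<close>.
\<close>
lemma covering_number_separated_le:
  fixes t :: "real ^ 'n::finite"
  assumes F: "is_attractor c t F" and sep: "separated_pieces c t g F"
    and c: "0 < c" "c < 1" "0 < g"
    and D: "\<And>x y. x \<in> F \<Longrightarrow> y \<in> F \<Longrightarrow> dist x y < D"
    and "x \<in> F" "m \<le> n" "0 < r" "0 < m \<Longrightarrow> R \<le> c ^ m * g" "2 * D * c ^ n \<le> r"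
  shows "covering_number r (ball x R \<inter> F) \<le> CARD('n) ^ (n - m)"
proof -
  obtain w x' where w: "length w = m" "x' \<in> F" "x = word_point c t w + c ^ m * x'"
    using is_attractor_expansion [OF F \<open>x \<in> F\<close>] .
  define B where "B v = ball (word_point c t (w @ v) + c ^ n * x) (r / 2)" for v
  let ?W = "{v :: 'n list. length v = n - m}"
  have "open_cover r (ball x R \<inter> F) (B ` ?W)"
    unfolding open_cover_def
  proof (intro conjI ballI subsetI)
    show "finite (B ` ?W)" using finite_words by auto
  next
    fix U assume "U \<in> B ` ?W"
    then show "open U" "bounded U" "diameter U \<le> r"
      using \<open>0 < r\<close> by (auto simp: B_def)
  next
    fix y assume y: "y \<in> ball x R \<inter> F"
    then obtain w2 y' where w2: "length w2 = m" "y' \<in> F" "y = word_point c t w2 + c ^ m * y'"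
      using is_attractor_expansion [OF F] by blast
    have "w2 = w"
    proof (rule ccontr)
      assume "w2 \<noteq> w"
      then have "c ^ m * g < dist x y"
        using separated_word_pieces [OF F sep c w(1) w2(1)] w w2 by (auto simp: dist_real_def)
      moreover have "0 < m" using \<open>w2 \<noteq> w\<close> w w2 by (cases m) auto
      ultimately show False using y assms by auto
    qed
    obtain v z where v: "length v = n - m" "z \<in> F" "y' = word_point c t v + c ^ (n - m) * z"
      using is_attractor_expansion [OF F \<open>y' \<in> F\<close>] .
    have "y = word_point c t (w @ v) + c ^ m * c ^ (n - m) * z"
      using w v w2 \<open>w2 = w\<close> by (simp add: word_point_append algebra_simps)
    also have "c ^ m * c ^ (n - m) = c ^ n"
      using \<open>m \<le> n\<close> by (simp flip: power_add)
    finally have "dist (word_point c t (w @ v) + c ^ n * x) y = c ^ n * dist x z"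
      using c by (simp add: dist_real_def abs_mult flip: right_diff_distrib)
    also have "\<dots> < c ^ n * D" using D [OF \<open>x \<in> F\<close> \<open>z \<in> F\<close>] c by simp
    finally have "dist (word_point c t (w @ v) + c ^ n * x) y < D * c ^ n" by (simp add: mult.commute)
    then have "y \<in> B v" using \<open>2 * D * c ^ n \<le> r\<close> unfolding B_def mem_ball by linarith
    then show "y \<in> \<Union> (B ` ?W)" using v by blast
  qed
  then have "covering_number r (ball x R \<inter> F) \<le> card (B ` ?W)" by (rule covering_number_le)
  also have "\<dots> \<le> CARD('n) ^ (n - m)"
    using card_image_le [OF finite_words, of B "n - m"] by (simp add: card_words)
  finally show ?thesis .
qed

text \<open>
  Choose \<open>m\<close> with \<open>c\<^sup>m\<close> comparable to \<open>R\<close>, or \<open>0\<close> if \<open>R\<close> is large, and \<open>n\<close> with \<open>c\<^sup>n\<close> comparable to \<open>r\<close>.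
  The number of level-\<open>n\<close> pieces in one level-\<open>m\<close> piece is \<open>((1 / c) ^ (n - m)) powr s\<close>, which is at most a constant times
  \<open>(R / r) powr s\<close>.
\<close>
lemma assouad_exponent_separated:
  fixes t :: "real ^ 'n::finite"
  assumes F: "is_attractor c t F" and sep: "separated_pieces c t g F"
    and c: "0 < c" "c < 1" "0 < g"
    and s: "0 \<le> s" "real CARD('n) = (1 / c) powr s"
  shows "assouad_exponent F s"
proof -
  have "bounded F" using F by (auto simp: is_attractor_def compact_imp_bounded)
  then obtain D0 where D0: "\<And>x y. x \<in> F \<Longrightarrow> y \<in> F \<Longrightarrow> dist x y \<le> D0"
    by (meson bounded_two_points)
  define D where "D = max D0 0 + 1"
  have D: "\<And>x y. x \<in> F \<Longrightarrow> y \<in> F \<Longrightarrow> dist x y < D" "0 < D"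
    using D0 unfolding D_def by fastforce+
  define A where "A = max 1 (2 * D / (g * c\<^sup>2))"
  have A: "1 \<le> A" "2 * D / (g * c\<^sup>2) \<le> A" by (auto simp: A_def)
  show ?thesis
    unfolding assouad_exponent_def
  proof (intro conjI exI [of _ "A powr s"] allI impI ballI)
    show "0 < A powr s" using A by simp
  next
    fix R r x :: real
    assume "0 < R" "r \<in> {0<..<R}" "x \<in> F"
    then have r: "0 < r" "r < R" by auto
    \<comment> \<open>The largest level whose gap is at least \<open>R\<close>, or \<open>0\<close> if there is none.\<close>
    obtain m where m: "0 < m \<Longrightarrow> R \<le> c ^ m * g" "c ^ Suc m * g < R"
    proof -
      obtain k where "c ^ k < R / g"
        using real_arch_pow_inv [of "R / g" c] c \<open>0 < R\<close> by auto
      then have k: "c ^ k * g < R" using c by (simp add: field_simps)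
      define k0 where "k0 = (LEAST k. c ^ k * g < R)"
      have k0: "c ^ k0 * g < R" "\<And>j. j < k0 \<Longrightarrow> \<not> c ^ j * g < R"
        unfolding k0_def using k by (auto intro: LeastI dest: not_less_Least)
      show thesis
      proof (cases k0)
        case 0
        have "c * g < g" using c by simp
        then show thesis using that [of 0] k0 0 by auto
      next
        case (Suc m)
        then show thesis using that [of m] k0 by force
      qed
    qed
    obtain k where "c ^ k < r / (2 * D)"
      using real_arch_pow_inv [of "r / (2 * D)" c] c r D by auto
    then have k: "2 * D * c ^ k \<le> r" using D by (simp add: field_simps)
    define n where "n = (LEAST k. 2 * D * c ^ k \<le> r)"
    have n: "2 * D * c ^ n \<le> r" "\<And>j. j < n \<Longrightarrow> r < 2 * D * c ^ j"
      unfolding n_def using k by (auto intro: LeastI dest: not_less_Least)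
    have N: "(1 / c) ^ (max m n - m) \<le> A * (R / r)"
    proof (cases "n \<le> m")
      case True
      have "1 * 1 \<le> A * (R / r)" using A r by (intro mult_mono) auto
      then show ?thesis using True by simp
    next
      case False
      then obtain j where j: "n = Suc j" "m \<le> j" by (cases n) auto
      have eq: "c ^ Suc m * c ^ (n - m) = c\<^sup>2 * c ^ j"
        using j by (simp flip: power_add power_Suc)
      have "r \<le> 2 * D * c ^ j" using n j by force
      also have "\<dots> = 2 * D / (g * c\<^sup>2) * (c ^ Suc m * g * c ^ (n - m))"
        using c eq by (simp add: field_simps)
      also have "\<dots> \<le> A * (R * c ^ (n - m))"
        using A m c D r by (intro mult_mono) auto
      finally have "(1 / c) ^ (n - m) \<le> A * (R / r)"
        using c r by (simp add: field_simps)
      then show ?thesis using False by (simp add: max_def)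
    qed
    have "2 * D * c ^ max m n \<le> 2 * D * c ^ n"
      using c D by (intro mult_left_mono power_decreasing) auto
    then have "covering_number r (ball x R \<inter> F) \<le> CARD('n) ^ (max m n - m)"
      using n m r by (intro covering_number_separated_le [OF F sep c D(1) \<open>x \<in> F\<close>]) auto
    then have "real (covering_number r (ball x R \<inter> F)) \<le> real CARD('n) ^ (max m n - m)"
      by (metis of_nat_le_iff of_nat_power)
    also have "\<dots> = ((1 / c) ^ (max m n - m)) powr s"
      using c by (simp add: s powr_power powr_realpow [symmetric] powr_powr mult.commute)
    also have "\<dots> \<le> (A * (R / r)) powr s"
      using N c s by (intro powr_mono2) auto
    also have "\<dots> = A powr s * (R / r) powr s"
      by (rule powr_mult)
    finally show "real (covering_number r (ball x R \<inter> F)) \<le> A powr s * (R / r) powr s" .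
  qed (use s in auto)
qed

text \<open>
  The \<open>CARD('n) ^ n\<close> pieces of level \<open>n\<close> contain that many points at mutual distance more than \<open>c\<^sup>n g\<close>, all
  inside one fixed ball. Letting \<open>n\<close> grow bounds the exponent from below.
\<close>
lemma assouad_exponent_separated_ge:
  fixes t :: "real ^ 'n::finite"
  assumes F: "is_attractor c t F" and sep: "separated_pieces c t g F"
    and c: "0 < c" "c < 1" "0 < g"
    and s: "real CARD('n) = (1 / c) powr s"
    and exponent: "assouad_exponent F \<sigma>"
  shows "s \<le> \<sigma>"
proof (rule ccontr)
  assume "\<not> s \<le> \<sigma>"
  obtain C where C: "0 < C" "\<And>R r x. 0 < R \<Longrightarrow> r \<in> {0<..<R} \<Longrightarrow> x \<in> F \<Longrightarrow>
      real (covering_number r (ball x R \<inter> F)) \<le> C * (R / r) powr \<sigma>"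
    using exponent unfolding assouad_exponent_def by blast
  obtain x0 where x0: "x0 \<in> F" using F by (auto simp: is_attractor_def)
  have "bounded F" using F by (auto simp: is_attractor_def compact_imp_bounded)
  then obtain D where D: "\<And>y. y \<in> F \<Longrightarrow> dist x0 y \<le> D"
    using bounded_any_center by blast
  define R where "R = max D g + 1"
  have "g < R" by (simp add: R_def)
  moreover have "y \<in> ball x0 R" if "y \<in> F" for y
    using D [OF that] by (simp add: R_def)
  ultimately have R: "g < R" "ball x0 R \<inter> F = F" by blast+
  have le: "((1 / c) powr (s - \<sigma>)) ^ n \<le> C * (R / g) powr \<sigma>" for n
  proof -
    have "c ^ n * g \<le> 1 * g" using c by (intro mult_right_mono power_le_one) auto
    then have r: "0 < c ^ n * g" "c ^ n * g < R" using c R(1) by (simp, linarith)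
    define P where "P w = word_point c t w + c ^ n * x0" for w
    let ?W = "{w :: 'n list. length w = n}"
    have P: "c ^ n * g < dist (P w) (P v)" if "w \<in> ?W" "v \<in> ?W" "w \<noteq> v" for w v
      using separated_word_pieces [OF F sep c, of w n v x0 x0] that x0
      unfolding P_def dist_real_def by simp
    have "inj_on P ?W"
    proof (rule inj_onI, rule ccontr)
      fix w v assume "w \<in> ?W" "v \<in> ?W" "P w = P v" "w \<noteq> v"
      then show False using P [of w v] r by simp
    qed
    then have "CARD('n) ^ n = card (P ` ?W)" by (simp add: card_image card_words)
    also have "\<dots> \<le> covering_number (c ^ n * g) (ball x0 R \<inter> F)"
    proof (rule card_separated_le_covering_number)
      show "P ` ?W \<subseteq> ball x0 R \<inter> F"
        unfolding R(2) using is_attractor_word_point_in [OF F x0] by (auto simp: P_def)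
    next
      fix x y assume "x \<in> P ` ?W" "y \<in> P ` ?W" "x \<noteq> y"
      then show "c ^ n * g < dist x y" using P by blast
    qed (use r in auto)
    finally have "real CARD('n) ^ n \<le> real (covering_number (c ^ n * g) (ball x0 R \<inter> F))"
      by (metis of_nat_le_iff of_nat_power)
    also have "\<dots> \<le> C * (R / (c ^ n * g)) powr \<sigma>"
      using r x0 by (intro C) auto
    also have "R / (c ^ n * g) = (R / g) * (1 / c) ^ n"
      using c by (simp add: power_one_over)
    also have "((R / g) * (1 / c) ^ n) powr \<sigma> = (R / g) powr \<sigma> * ((1 / c) powr \<sigma>) ^ n"
      unfolding powr_mult
      using c by (simp add: powr_power powr_realpow [symmetric] powr_powr mult.commute)
    finally have "((1 / c) powr s) ^ n \<le> C * (R / g) powr \<sigma> * ((1 / c) powr \<sigma>) ^ n"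
      by (simp add: s mult.assoc)
    then show ?thesis
      using c by (simp add: powr_diff power_divide pos_divide_le_eq)
  qed
  have "1 < (1 / c) powr (s - \<sigma>)" using c \<open>\<not> s \<le> \<sigma>\<close> by simp
  then obtain n where "C * (R / g) powr \<sigma> < ((1 / c) powr (s - \<sigma>)) ^ n"
    using real_arch_pow by blast
  then show False using le [of n] by simp
qed

lemma assouad_dim_separated:
  fixes t :: "real ^ 'n::finite"
  assumes F: "is_attractor c t F" and sep: "separated_pieces c t g F"
    and c: "0 < c" "c < 1" "0 < g"
    and s: "0 \<le> s" "real CARD('n) = (1 / c) powr s"
  shows "assouad_dim F = s"
proof (rule antisym)
  show "assouad_dim F \<le> s"
    by (rule assouad_dim_le [OF assouad_exponent_separated [OF assms]])
  show "s \<le> assouad_dim F"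
    by (rule assouad_dim_ge [OF assouad_exponent_separated_ge [OF F sep c s(2)]])
qed

text \<open>
  The largest point \<open>M\<close> of \<open>F\<close> is the image of a point that is at most \<open>M\<close>, so \<open>M \<le> c M + hi\<close>; the smallest
  point is treated in the same way.
\<close>
lemma is_attractor_bounds:
  assumes F: "is_attractor c t F" and c: "0 < c" "c < 1"
    and t: "\<And>i. lo \<le> t $ i" "\<And>i. t $ i \<le> hi" and "x \<in> F"
  shows "lo \<le> (1 - c) * x" "(1 - c) * x \<le> hi"
proof -
  have F': "compact F" "F \<noteq> {}" "\<And>x. x \<in> F \<Longrightarrow> \<exists>i. \<exists>y\<in>F. x = c * y + t $ i"
    using F unfolding is_attractor_def by blast+
  obtain M where M: "M \<in> F" "\<And>y. y \<in> F \<Longrightarrow> y \<le> M"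
    using compact_attains_sup [OF F'(1,2)] by blast
  obtain i y where y: "y \<in> F" "M = c * y + t $ i" using F'(3) [OF M(1)] by blast
  have "c * y \<le> c * M" using M(2) [OF y(1)] c by simp
  then have "M \<le> c * M + hi" using y(2) t(2) [of i] by linarith
  moreover have "(1 - c) * x \<le> (1 - c) * M" using M \<open>x \<in> F\<close> c by simp
  ultimately show "(1 - c) * x \<le> hi" by (simp add: algebra_simps)
  obtain m where m: "m \<in> F" "\<And>y. y \<in> F \<Longrightarrow> m \<le> y"
    using compact_attains_inf [OF F'(1,2)] by blast
  obtain j z where z: "z \<in> F" "m = c * z + t $ j" using F'(3) [OF m(1)] by blast
  have "c * m \<le> c * z" using m(2) [OF z(1)] c by simp
  then have "c * m + lo \<le> m" using z(2) t(1) [of j] by linarith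
  moreover have "(1 - c) * m \<le> (1 - c) * x" using m \<open>x \<in> F\<close> c by simp
  ultimately show "lo \<le> (1 - c) * x" by (simp add: algebra_simps)
qed

text \<open>
  The inequalities say \<open>t\<^sub>2 - t\<^sub>1 > c h\<close> and \<open>t\<^sub>3 - t\<^sub>2 > c h\<close> with \<open>h = (t\<^sub>3 - t\<^sub>1) / (1 - c)\<close>: neighbouring pieces,
  which lie in intervals of length \<open>c h\<close>, are disjoint.
\<close>
definition separation_region :: "real \<Rightarrow> (real ^ 3) set" where
  "separation_region c = {t. t $ 1 < t $ 3 \<and>
     c * (t $ 3 - t $ 1) < (1 - c) * (t $ 2 - t $ 1) \<and>
     c * (t $ 3 - t $ 1) < (1 - c) * (t $ 3 - t $ 2)}"

lemma open_separation_region: "open (separation_region c)"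
  unfolding separation_region_def
  by (intro open_Collect_conj open_Collect_less continuous_intros)

lemma assouad_dim_attractor_separated:
  fixes t :: "real ^ 3"
  assumes c: "0 < c" "c < 1" and s: "0 \<le> s" "(1 / c) powr s = 3"
    and t: "t \<in> separation_region c"
  shows "assouad_dim (attractor c t) = s"
proof -
  note F = is_attractor_attractor [OF c, of t]
  have pos: "t $ 1 < t $ 3"
    and less: "c * (t $ 3 - t $ 1) < (1 - c) * (t $ 2 - t $ 1)"
      "c * (t $ 3 - t $ 1) < (1 - c) * (t $ 3 - t $ 2)"
    using t by (auto simp: separation_region_def)
  define h where "h = (t $ 3 - t $ 1) / (1 - c)"
  have h: "(1 - c) * h = t $ 3 - t $ 1" using c by (simp add: h_def)
  have eq: "(1 - c) * (c * h) = c * (t $ 3 - t $ 1)" unfolding h [symmetric] by simp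
  have "(1 - c) * (c * h) < (1 - c) * (t $ 2 - t $ 1)"
     "(1 - c) * (c * h) < (1 - c) * (t $ 3 - t $ 2)" unfolding eq by (rule less)+
  then have ch: "c * h < t $ 2 - t $ 1" "c * h < t $ 3 - t $ 2" using c by simp_all
  have "0 < c * h" using c pos by (simp add: h_def)
  define g where "g = min (t $ 2 - t $ 1) (t $ 3 - t $ 2) - c * h"
  have "g + c * h \<le> t $ 2 - t $ 1" "g + c * h \<le> t $ 3 - t $ 2" "0 < g + c * h"
    using ch \<open>0 < c * h\<close> by (simp_all add: g_def)
  then have digits: "\<forall>i j. i \<noteq> j \<longrightarrow> t $ i - t $ j \<le> - (g + c * h) \<or> g + c * h \<le> t $ i - t $ j"
    unfolding forall_3 by (intro conjI impI; (linarith | simp))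
  have "separated_pieces c t g (attractor c t)"
    unfolding separated_pieces_def
  proof (intro allI ballI impI)
    fix i j :: 3 and x y assume xy: "x \<in> attractor c t" "y \<in> attractor c t" "i \<noteq> j"
    have "t $ 1 \<le> t $ k" "t $ k \<le> t $ 3" for k
      using exhaust_3 [of k] ch \<open>0 < c * h\<close> by auto
    note bounds = is_attractor_bounds [OF F c this]
    have "(1 - c) * (x - y) \<le> (1 - c) * h" "(1 - c) * (y - x) \<le> (1 - c) * h"
      using bounds [OF xy(1)] bounds [OF xy(2)] unfolding h by (simp_all add: algebra_simps)
    then have "x - y \<le> h" "y - x \<le> h" using c by simp_all
    define X where "X = c * (x - y)"
    define T where "T = t $ i - t $ j"
    have "X \<le> c * h" "c * (y - x) \<le> c * h"
      using \<open>x - y \<le> h\<close> \<open>y - x \<le> h\<close> c by (simp_all add: X_def)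
    then have X: "X \<le> c * h" "- (c * h) \<le> X" by (simp_all add: X_def algebra_simps)
    have T: "T \<le> - (g + c * h) \<or> g + c * h \<le> T"
      using digits xy(3) by (simp add: T_def)
    have "c * x + t $ i - (c * y + t $ j) = X + T"
      by (simp add: X_def T_def algebra_simps)
    then show "g \<le> \<bar>c * x + t $ i - (c * y + t $ j)\<bar>" using X T by linarith
  qed
  then show ?thesis
    using c s ch by (intro assouad_dim_separated [OF F, of g]) (auto simp: g_def)
qed

section \<open>Near coincidences force dimension one\<close>

text \<open>
  The parameters for which two words of some length \<open>n\<close> induce maps that differ by a nonzero
  translation smaller than \<open>\<epsilon> c\<^sup>n\<close>. Swapping the words makes the translation positive.
\<close>
definition near_coincidence_set :: "real \<Rightarrow> real \<Rightarrow> (real ^ 'n::finite) set" where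
  "near_coincidence_set c \<epsilon> = {t. \<exists>w v. length w = length v \<and>
     0 < word_point c t w - word_point c t v \<and>
     word_point c t w - word_point c t v < \<epsilon> * c ^ length w}"

text \<open>
  This is the failure of the weak separation property for an iterated function system with a single
  contraction ratio: exact coincidences of words are disregarded, but small nonzero relative
  displacements accumulate at \<open>0\<close>.
\<close>
definition near_coincidences :: "real \<Rightarrow> real ^ 'n::finite \<Rightarrow> bool" where
  "near_coincidences c t \<longleftrightarrow> (\<forall>\<epsilon>>0. t \<in> near_coincidence_set c \<epsilon>)"

text \<open>
  Given \<open>m + 1\<close> points with gaps of order \<open>c\<^sup>N\<close>, choose words \<open>w\<close>, \<open>v\<close> whose relative displacement is below
  \<open>c\<^sup>N\<close> and prolong both by a common word \<open>u\<close> until their displacement \<open>\<theta>\<close> is of the order of \<open>c\<close> to the total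
  length. Prefixing the old words by \<open>v u\<close> keeps their gaps in proportion, and replacing \<open>v\<close> by \<open>w\<close> in
  the last of them produces one more point at the distance \<open>\<theta>\<close>.
\<close>
lemma near_coincidences_progression:
  assumes c: "0 < c" "c < 1" and near: "near_coincidences c t"
  shows "\<exists>N W. \<forall>l\<le>m. length (W l) = N \<and>
    (l < m \<longrightarrow> c ^ Suc N \<le> word_point c t (W (Suc l)) - word_point c t (W l) \<and>
       word_point c t (W (Suc l)) - word_point c t (W l) \<le> c ^ N)"
proof (induction m)
  case 0
  show ?case by (intro exI [of _ 0] exI [of _ "\<lambda>_. []"]) auto
next
  case (Suc m)
  let ?p = "word_point c t"
  obtain N W where W: "\<And>l. l \<le> m \<Longrightarrow> length (W l) = N"
    "\<And>l. l < m \<Longrightarrow> c ^ Suc N \<le> ?p (W (Suc l)) - ?p (W l)"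
    "\<And>l. l < m \<Longrightarrow> ?p (W (Suc l)) - ?p (W l) \<le> c ^ N"
    using Suc.IH by (metis less_imp_le)
  obtain w v where wv: "length w = length v" "0 < ?p w - ?p v" "?p w - ?p v < c ^ N * c ^ length v"
    using near c unfolding near_coincidences_def near_coincidence_set_def by (smt (verit) mem_Collect_eq zero_less_power)
  define \<theta> where "\<theta> = ?p w - ?p v"
  have \<theta>: "0 < \<theta>" "\<theta> < c ^ (length v + N)"
    using wv by (simp_all add: \<theta>_def power_add mult.commute)
  obtain k where k: "c ^ k < \<theta>"
    using real_arch_pow_inv [of \<theta> c] c \<theta> by auto
  define k0 where "k0 = (LEAST k. c ^ k < \<theta>)"
  have k0: "c ^ k0 < \<theta>" "\<And>j. j < k0 \<Longrightarrow> \<not> c ^ j < \<theta>"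
    unfolding k0_def using k by (auto intro: LeastI dest: not_less_Least)
  have "\<not> k0 \<le> length v + N"
  proof
    assume "k0 \<le> length v + N"
    then have "c ^ (length v + N) \<le> c ^ k0" using c by (intro power_decreasing) auto
    then show False using k0 \<theta> by simp
  qed
  then obtain K where K: "k0 = Suc (length v + K + N)"
    by (metis less_natE not_le add.assoc add.commute)
  define u where "u = replicate K (undefined :: 'a)"
  define W' where "W' l = (if l \<le> m then v @ u @ W l else w @ u @ W m)" for l
  have p: "?p (v @ u @ x) = ?p v + c ^ length v * ?p u + c ^ (length v + K) * ?p x"
    "?p (w @ u @ x) = ?p w + c ^ length v * ?p u + c ^ (length v + K) * ?p x" for x
    using wv by (simp_all add: word_point_append u_def power_add algebra_simps)
  have step: "c ^ Suc (length v + K + N) \<le> ?p (W' (Suc l)) - ?p (W' l) \<and>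
      ?p (W' (Suc l)) - ?p (W' l) \<le> c ^ (length v + K + N)" if "l < Suc m" for l
  proof (cases "l = m")
    case True
    then have "?p (W' (Suc l)) - ?p (W' l) = \<theta>" by (simp add: W'_def p \<theta>_def)
    then show ?thesis using k0 K by (metis less_imp_le not_less lessI)
  next
    case False
    then have "l < m" using that by simp
    then have "?p (W' (Suc l)) - ?p (W' l) = c ^ (length v + K) * (?p (W (Suc l)) - ?p (W l))"
      by (simp add: W'_def p algebra_simps)
    moreover have "c ^ (length v + K) * c ^ Suc N \<le> c ^ (length v + K) * (?p (W (Suc l)) - ?p (W l))"
      using W(2) [OF \<open>l < m\<close>] c by (intro mult_left_mono) auto
    moreover have "c ^ (length v + K) * (?p (W (Suc l)) - ?p (W l)) \<le> c ^ (length v + K) * c ^ N"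
      using W(3) [OF \<open>l < m\<close>] c by (intro mult_left_mono) auto
    ultimately show ?thesis by (simp add: power_add mult.assoc mult.left_commute)
  qed
  have "length (W' l) = length v + K + N" for l
    using wv W(1) by (simp add: W'_def u_def)
  then show ?case using step by blast
qed

text \<open>
  A progression of \<open>m + 1\<close> points with gaps between \<open>c\<^sup>N\<^sup>+\<^sup>1\<close> and \<open>c\<^sup>N\<close> fits into a ball of radius
  \<open>R = (m + 1) c\<^sup>N\<close> and needs \<open>m + 1\<close> sets of diameter \<open>r = c\<^sup>N\<^sup>+\<^sup>1 / 2\<close>, while \<open>R / r = 2 (m + 1) / c\<close>. An exponent
  below 1 cannot accommodate this for large \<open>m\<close>.
\<close>
lemma assouad_exponent_near_coincidences:
  assumes F: "is_attractor c t F" and c: "0 < c" "c < 1" and near: "near_coincidences c t"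
    and exponent: "assouad_exponent F \<sigma>"
  shows "1 \<le> \<sigma>"
proof (rule ccontr)
  assume "\<not> 1 \<le> \<sigma>"
  obtain C where C: "0 < C" "\<And>R r x. 0 < R \<Longrightarrow> r \<in> {0<..<R} \<Longrightarrow> x \<in> F \<Longrightarrow>
      real (covering_number r (ball x R \<inter> F)) \<le> C * (R / r) powr \<sigma>"
    using exponent unfolding assouad_exponent_def by blast
  obtain x0 where x0: "x0 \<in> F" using F by (auto simp: is_attractor_def)
  define B where "B = C * (2 / c) powr \<sigma>"
  have "0 < B" using C c by (simp add: B_def)
  have le: "real (Suc m) powr (1 - \<sigma>) \<le> B" for m
  proof -
    obtain N W where W: "\<And>l. l \<le> m \<Longrightarrow> length (W l) = N"
      "\<And>l. l < m \<Longrightarrow> c ^ Suc N \<le> word_point c t (W (Suc l)) - word_point c t (W l)"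
      "\<And>l. l < m \<Longrightarrow> word_point c t (W (Suc l)) - word_point c t (W l) \<le> c ^ N"
      using near_coincidences_progression [OF c near, of m] by (metis less_imp_le)
    define P where "P l = word_point c t (W l) + c ^ N * x0" for l
    have PF: "P l \<in> F" if "l \<le> m" for l
      using is_attractor_word_point_in [OF F x0, of "W l"] W(1) [OF that] by (simp add: P_def)
    have gap: "real d * c ^ Suc N \<le> P (l + d) - P l \<and> P (l + d) - P l \<le> real d * c ^ N"
      if "l + d \<le> m" for l d
      using that
    proof (induction d)
      case (Suc d)
      then have "l + d < m" by simp
      from W(2,3) [OF this] Suc show ?case by (simp add: P_def algebra_simps)
    qed simp
    define R where "R = real (Suc m) * c ^ N"
    define r where "r = c ^ Suc N / 2"
    have "c ^ Suc N < c ^ N" using c by simp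
    then have r: "0 < r" "r < c ^ Suc N" "r < R"
      using c mult_right_mono [of 1 "real (Suc m)" "c ^ N"] unfolding r_def R_def by auto
    have far: "r < P k - P l" if "l < k" "k \<le> m" for k l
    proof -
      have "1 * c ^ Suc N \<le> real (k - l) * c ^ Suc N"
        using that c by (intro mult_right_mono) auto
      also have "\<dots> \<le> P k - P l" using gap [of l "k - l"] that by simp
      finally show ?thesis using r by simp
    qed
    have "inj_on P {..m}"
    proof (rule inj_onI, rule ccontr)
      fix k l assume "k \<in> {..m}" "l \<in> {..m}" "P k = P l" "k \<noteq> l"
      then show False using far [of k l] far [of l k] r(1) by (auto simp: neq_iff)
    qed
    then have "Suc m = card (P ` {..m})" by (simp add: card_image)
    also have "\<dots> \<le> covering_number r (ball (P 0) R \<inter> F)"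
    proof (rule card_separated_le_covering_number)
      show "P ` {..m} \<subseteq> ball (P 0) R \<inter> F"
      proof (intro subsetI IntI)
        fix x assume "x \<in> P ` {..m}"
        then obtain l where l: "l \<le> m" "x = P l" by auto
        then show "x \<in> F" using PF by simp
        have "0 \<le> real l * c ^ Suc N" using c by simp
        with gap [of 0 l] l have "0 \<le> P l - P 0" "P l - P 0 \<le> real l * c ^ N"
          by (simp_all del: power_Suc)
        moreover have "real l * c ^ N < R"
          unfolding R_def using l c by (intro mult_strict_right_mono) auto
        ultimately show "x \<in> ball (P 0) R" using l by (simp add: dist_real_def)
      qed
    next
      fix x y assume "x \<in> P ` {..m}" "y \<in> P ` {..m}" "x \<noteq> y"
      then obtain k l where kl: "k \<le> m" "l \<le> m" "k \<noteq> l" "x = P k" "y = P l" by auto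
      then show "r < dist x y"
        using far [of k l] far [of l k] by (cases "k < l") (auto simp: dist_real_def)
    qed (use r in auto)
    finally have "real (Suc m) \<le> real (covering_number r (ball (P 0) R \<inter> F))" by simp
    also have "\<dots> \<le> C * (R / r) powr \<sigma>"
      using r PF by (intro C) auto
    also have "R / r = real (Suc m) * (2 / c)"
      using c by (simp add: R_def r_def field_simps)
    also have "C * (real (Suc m) * (2 / c)) powr \<sigma> = B * real (Suc m) powr \<sigma>"
      unfolding B_def powr_mult by (simp only: mult_ac)
    finally have "real (Suc m) powr 1 \<le> B * real (Suc m) powr \<sigma>" by simp
    then show ?thesis by (simp add: powr_diff pos_divide_le_eq)
  qed
  obtain m :: nat where "B powr (1 / (1 - \<sigma>)) < real m" using reals_Archimedean2 by blast
  then have "B powr (1 / (1 - \<sigma>)) < real (Suc m)" by simp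
  then have "(B powr (1 / (1 - \<sigma>))) powr (1 - \<sigma>) < real (Suc m) powr (1 - \<sigma>)"
    using \<open>\<not> 1 \<le> \<sigma>\<close> by (intro powr_less_mono2) auto
  then show False using le [of m] \<open>0 < B\<close> \<open>\<not> 1 \<le> \<sigma>\<close> by (simp add: powr_powr)
qed

section \<open>Overlapping parameters and the dichotomy\<close>

text \<open>
  With \<open>a = t\<^sub>2 - t\<^sub>1\<close>, \<open>w = t\<^sub>3 - t\<^sub>1\<close> and \<open>h = w / (1 - c)\<close> the last two conditions are \<open>a < c h\<close>, an overlap of the
  intervals that carry the first two pieces, and \<open>w - 2 a < 2 c h\<close>, which closes the gap between the differences \<open>a\<close> and \<open>w - a\<close>.
  The condition \<open>w < 1\<close> bounds \<open>h\<close> and thereby makes the porosity constant uniform.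
\<close>
definition overlap_region :: "real \<Rightarrow> (real ^ 3) set" where
  "overlap_region c = {t. t $ 1 < t $ 2 \<and> t $ 3 - t $ 1 < 1 \<and>
     (1 - c) * (t $ 2 - t $ 1) < c * (t $ 3 - t $ 1) \<and>
     (1 - c) * ((t $ 3 - t $ 1) - 2 * (t $ 2 - t $ 1)) < 2 * c * (t $ 3 - t $ 1)}"

text \<open>
  By symmetry let \<open>y \<ge> 0\<close>. The intervals of radius \<open>c h\<close> about \<open>0\<close>, \<open>a\<close>, \<open>w - a\<close>, \<open>w\<close> cover \<open>[0, h]\<close>: consecutive
  centres are less than \<open>2 c h\<close> apart, and \<open>w + c h = h\<close>.
\<close>
lemma digit_differences_cover:
  assumes c: "0 < c" "c < 1" and t: "t \<in> overlap_region c"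
    and h: "(1 - c) * h = t $ 3 - t $ 1" and y: "\<bar>y\<bar> \<le> h"
  shows "\<exists>i j. \<bar>y - (t $ i - t $ j)\<bar> \<le> c * h"
proof -
  define a where "a = t $ 2 - t $ 1"
  define e where "e = c * h"
  have w: "t $ 3 - t $ 1 = h - e" using h by (simp add: e_def algebra_simps)
  have eq: "(1 - c) * e = c * (t $ 3 - t $ 1)" unfolding h [symmetric] e_def by simp
  have "(1 - c) * a < (1 - c) * e" "(1 - c) * (h - e - 2 * a) < 2 * ((1 - c) * e)"
    unfolding eq w [symmetric] using t by (simp_all add: overlap_region_def a_def)
  then have "(1 - c) * a < (1 - c) * e" "(1 - c) * (h - e - 2 * a) < (1 - c) * (2 * e)"
    by simp_all
  then have ae: "a < e" "h - e - 2 * a < 2 * e" using c by simp_all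
  have a: "0 < a" using t by (simp add: overlap_region_def a_def)
  have "\<bar>y\<bar> \<le> e \<or> \<bar>\<bar>y\<bar> - a\<bar> \<le> e \<or> \<bar>\<bar>y\<bar> - (h - e - a)\<bar> \<le> e \<or> \<bar>\<bar>y\<bar> - (h - e)\<bar> \<le> e"
    using ae a y by linarith
  moreover have "t $ 1 - t $ 1 = 0" "t $ 2 - t $ 1 = a" "t $ 3 - t $ 2 = h - e - a" "t $ 3 - t $ 1 = h - e"
    using w by (simp_all add: a_def)
  ultimately have "\<exists>i j. \<bar>\<bar>y\<bar> - (t $ i - t $ j)\<bar> \<le> e"
    by (metis diff_zero abs_abs)
  then obtain i j where ij: "\<bar>\<bar>y\<bar> - (t $ i - t $ j)\<bar> \<le> e" by blast
  show ?thesis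
  proof (cases "0 \<le> y")
    case True
    then have "\<bar>y - (t $ i - t $ j)\<bar> \<le> e" using ij by simp
    then show ?thesis unfolding e_def by blast
  next
    case False
    then have "\<bar>y - (t $ j - t $ i)\<bar> \<le> e" using ij by linarith
    then show ?thesis unfolding e_def by blast
  qed
qed

text \<open>
  Greedy expansion of \<open>y\<close> in base \<open>1 / c\<close> with the digits \<open>t\<^sub>i - t\<^sub>j\<close>: after subtracting a suitable digit and
  rescaling, the remainder is again in \<open>[-h, h]\<close>.
\<close>
lemma word_differences_approximate:
  assumes c: "0 < c" "c < 1" and t: "t \<in> overlap_region c"
    and h: "(1 - c) * h = t $ 3 - t $ 1" and y: "\<bar>y\<bar> \<le> h"
  shows "\<exists>u v. length u = n \<and> length v = n \<and>
    \<bar>y - (word_point c t u - word_point c t v)\<bar> \<le> c ^ n * h"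
  using y
proof (induction n arbitrary: y)
  case (Suc n)
  obtain i j where ij: "\<bar>y - (t $ i - t $ j)\<bar> \<le> c * h"
    using digit_differences_cover [OF c t h Suc.prems] by blast
  define z where "z = (y - (t $ i - t $ j)) / c"
  have z: "y = (t $ i - t $ j) + c * z" using c by (simp add: z_def)
  have "\<bar>z\<bar> \<le> h" using ij c by (simp add: z_def field_simps)
  then obtain u v where uv: "length u = n" "length v = n"
      "\<bar>z - (word_point c t u - word_point c t v)\<bar> \<le> c ^ n * h"
    using Suc.IH by blast
  have "y - (word_point c t (i # u) - word_point c t (j # v))
      = c * (z - (word_point c t u - word_point c t v))"
    by (simp add: z algebra_simps)
  then have "\<bar>y - (word_point c t (i # u) - word_point c t (j # v))\<bar>
      = c * \<bar>z - (word_point c t u - word_point c t v)\<bar>"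
    using c by (simp add: abs_mult)
  also have "\<dots> \<le> c ^ Suc n * h" using uv c by simp
  finally show ?case using uv by (metis length_Cons)
qed auto

lemma word_point_nonneg:
  assumes "0 \<le> c" "\<And>i. 0 \<le> t $ i"
  shows "0 \<le> word_point c t w"
  using assms by (induction w) auto

lemma open_near_coincidence_set: "open (near_coincidence_set c \<epsilon> :: (real ^ 'n::finite) set)"
proof -
  have cont: "continuous_on UNIV (\<lambda>t. word_point c t w)" for w :: "'n list"
    by (induction w) (auto intro!: continuous_intros)
  have "near_coincidence_set c \<epsilon> = (\<Union>w. \<Union>v\<in>{v. length w = length v}.
      {t :: real ^ 'n. 0 < word_point c t w - word_point c t v} \<inter>
      {t. word_point c t w - word_point c t v < \<epsilon> * c ^ length w})"
    unfolding near_coincidence_set_def by (simp only: set_eq_iff UN_iff Int_iff mem_Collect_eq) blast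
  also have "open \<dots>"
    by (intro open_UN ballI open_Int open_Collect_less continuous_intros cont)
  finally show ?thesis .
qed

lemma open_overlap_region: "open (overlap_region c)"
  unfolding overlap_region_def
  by (intro open_Collect_conj open_Collect_less continuous_intros)

text \<open>
  Expanding \<open>- (t\<^sub>2 - t\<^sub>1) / c\<close> yields words \<open>2 u\<close> and \<open>1 v\<close> of length \<open>N\<close> whose displacement \<open>g\<close> at \<open>t\<close> is at most
  \<open>h c\<^sup>N\<close>. Along the second coordinate axis \<open>g\<close> is affine with slope at least 1/2, so moving \<open>t\<close> by a
  multiple of \<open>c\<^sup>N\<close> reaches a parameter \<open>y\<close> with \<open>g y = \<epsilon> c\<^sup>N / 2\<close>. Since \<open>g\<close> is Lipschitz with constant 3,
  it stays between \<open>0\<close> and \<open>\<epsilon> c\<^sup>N\<close> on the ball of radius \<open>\<epsilon> c\<^sup>N / 6\<close> about \<open>y\<close>.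
\<close>
lemma overlap_region_holes:
  assumes c: "0 < c" "c < 1 / 3" and t: "t \<in> overlap_region c" and "0 < \<epsilon>" "0 < e"
  shows "\<exists>d y. 0 < d \<and> d < e \<and>
    ball y (\<epsilon> / (6 * (3 + 2 * \<epsilon>)) * d) \<subseteq> ball t d \<inter> near_coincidence_set c \<epsilon>"
proof -
  have c1: "c < 1" using c by simp
  define h where "h = (t $ 3 - t $ 1) / (1 - c)"
  have h: "(1 - c) * h = t $ 3 - t $ 1" using c by (simp add: h_def)
  have a: "0 < t $ 2 - t $ 1" "(1 - c) * (t $ 2 - t $ 1) < (1 - c) * (c * h)" "(1 - c) * h < 1"
    using t by (simp_all add: overlap_region_def h mult.left_commute [of "1 - c" c])
  then have ach: "t $ 2 - t $ 1 < c * h" using c by simp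
  have "0 < c * h" using a ach by linarith
  then have "0 < h" using c by (simp add: zero_less_mult_iff)
  have "h \<le> 3 / 2"
  proof -
    have "2 / 3 * h \<le> (1 - c) * h" using c \<open>0 < h\<close> by (intro mult_right_mono) auto
    then show ?thesis using a by simp
  qed
  obtain n where n: "c ^ n < e / (3 + 2 * \<epsilon>)"
    using real_arch_pow_inv [of "e / (3 + 2 * \<epsilon>)" c] c \<open>0 < \<epsilon>\<close> \<open>0 < e\<close> by auto
  define y0 where "y0 = - (t $ 2 - t $ 1) / c"
  have "\<bar>y0\<bar> \<le> h" using a ach c by (simp add: y0_def field_simps)
  then obtain u v where uv: "length u = n" "length v = n"
      "\<bar>y0 - (word_point c t u - word_point c t v)\<bar> \<le> c ^ n * h"
    using word_differences_approximate [OF c(1) c1 t h] by blast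
  define g where "g x = word_point c x (2 # u) - word_point c x (1 # v)" for x
  define N where "N = Suc n"
  define E where "E = axis (2 :: 3) (1 :: real)"
  have "g t = - c * (y0 - (word_point c t u - word_point c t v))"
    using c by (simp add: g_def y0_def field_simps)
  then have "\<bar>g t\<bar> = c * \<bar>y0 - (word_point c t u - word_point c t v)\<bar>"
    using c by (simp add: abs_mult)
  also have "\<dots> \<le> c * (c ^ n * h)" using uv c by (intro mult_left_mono) auto
  finally have gt: "\<bar>g t\<bar> \<le> h * c ^ N" by (simp add: N_def mult_ac)
  \<comment> \<open>The slope of \<open>g\<close> along the second axis: the first letters contribute 1, the later ones at
    most \<open>c / (1 - c)\<close> in absolute value.\<close>
  have gE: "1 / 2 \<le> g E"
  proof -
    have "norm E = 1" by (simp add: E_def)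
    then have "word_point c E v \<le> 1 / (1 - c)"
      using abs_word_point_le [of c E v] c by simp
    moreover have "1 / (1 - c) \<le> 3 / 2" using c by (simp add: field_simps)
    ultimately have "c * word_point c E v \<le> 1 / 3 * (3 / 2)"
      using c word_point_nonneg [of c E v] by (intro mult_mono) (auto simp: E_def axis_def)
    moreover have "0 \<le> c * word_point c E u"
      using c word_point_nonneg [of c E u] by (auto simp: E_def axis_def)
    moreover have "g E = 1 + c * word_point c E u - c * word_point c E v"
      by (simp add: g_def E_def axis_def)
    ultimately show ?thesis by simp
  qed
  define x where "x = (\<epsilon> * c ^ N / 2 - g t) / g E"
  define y where "y = t + x *\<^sub>R E"
  define d where "d = (3 + 2 * \<epsilon>) * c ^ N"
  have gy: "g y = \<epsilon> * c ^ N / 2"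
  proof -
    have "g y = g t + x * g E"
      unfolding g_def y_def word_point_add_scaleR by (simp only: algebra_simps)
    then show ?thesis using gE by (simp add: x_def)
  qed
  have cN: "0 < c ^ N" using c by simp
  have ball_y: "ball y (\<epsilon> * c ^ N / 6) \<subseteq> near_coincidence_set c \<epsilon>"
  proof
    fix z assume "z \<in> ball y (\<epsilon> * c ^ N / 6)"
    then have z: "norm (z - y) < \<epsilon> * c ^ N / 6" by (simp add: dist_norm norm_minus_commute)
    have lin: "word_point c z q - word_point c y q = word_point c (z - y) q" for q
      using word_point_add_scaleR [of c y 1 "z - y" q] by simp
    have "norm (z - y) / (1 - c) \<le> norm (z - y) * (3 / 2)"
      using c mult_left_mono [of "1 / (1 - c)" "3 / 2" "norm (z - y)"] by (simp add: field_simps)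
    then have "\<bar>word_point c (z - y) q\<bar> < \<epsilon> * c ^ N / 4" for q
      using abs_word_point_le [of c "z - y" q] c z by linarith
    from this [of "2 # u"] this [of "1 # v"] have "\<bar>g z - g y\<bar> < \<epsilon> * c ^ N / 2"
      unfolding g_def lin [symmetric] by linarith
    then have "0 < g z" "g z < \<epsilon> * c ^ N" using gy by linarith+
    then show "z \<in> near_coincidence_set c \<epsilon>"
      unfolding near_coincidence_set_def g_def N_def using uv by (intro CollectI exI [of _ "2 # u"] exI [of _ "1 # v"]) simp
  qed
  have "\<bar>x\<bar> \<le> (3 + \<epsilon>) * c ^ N"
  proof -
    have "\<bar>x\<bar> * (1 / 2) \<le> \<bar>x\<bar> * g E" using gE by (intro mult_left_mono) auto
    also have "\<dots> = \<bar>\<epsilon> * c ^ N / 2 - g t\<bar>" using gE by (simp add: x_def abs_divide)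
    also have "\<dots> \<le> \<epsilon> * c ^ N / 2 + h * c ^ N"
      using gt \<open>0 < \<epsilon>\<close> cN abs_triangle_ineq4 [of "\<epsilon> * c ^ N / 2" "g t"] by simp
    also have "h * c ^ N \<le> 3 / 2 * c ^ N" using \<open>h \<le> 3 / 2\<close> cN by (intro mult_right_mono) auto
    finally show ?thesis by (simp add: algebra_simps)
  qed
  moreover have "dist t y = \<bar>x\<bar>" by (simp add: y_def dist_norm E_def)
  ultimately have "dist t y + \<epsilon> * c ^ N / 6 \<le> (3 + \<epsilon>) * c ^ N + \<epsilon> * c ^ N" 
    using mult_pos_pos [OF \<open>0 < \<epsilon>\<close> cN] by linarith
  also have "\<dots> = d" by (simp add: d_def algebra_simps)
  finally have sub: "ball y (\<epsilon> * c ^ N / 6) \<subseteq> ball t d"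
    by (intro ball_subset_ball_iff [THEN iffD2]) (simp add: dist_commute)
  have "\<epsilon> / (6 * (3 + 2 * \<epsilon>)) * d = \<epsilon> * c ^ N / 6"
    using \<open>0 < \<epsilon>\<close> by (simp add: d_def field_simps)
  moreover have "0 < d" using \<open>0 < \<epsilon>\<close> cN by (simp add: d_def)
  moreover have "d < e"
  proof -
    have "c ^ N \<le> c ^ n" using c by (simp add: N_def mult_left_le_one_le)
    then have "c ^ N < e / (3 + 2 * \<epsilon>)" using n by simp
    then show ?thesis using \<open>0 < \<epsilon>\<close> by (simp add: d_def field_simps)
  qed
  ultimately show ?thesis using ball_y sub by (metis Int_greatest)
qed

lemma negligible_overlap_region_diff_near_coincidence_set:
  assumes c: "0 < c" "c < 1 / 3" and "0 < \<epsilon>"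
  shows "negligible (overlap_region c - near_coincidence_set c \<epsilon>)"
proof (rule porous_imp_negligible)
  show "overlap_region c - near_coincidence_set c \<epsilon> \<in> sets lebesgue"
    by (intro sets.Diff sets_completionI_sets)
      (simp_all add: borel_open open_overlap_region open_near_coincidence_set)
  show "0 < \<epsilon> / (6 * (3 + 2 * \<epsilon>))" using \<open>0 < \<epsilon>\<close> by simp
next
  fix t and e :: real assume "t \<in> overlap_region c - near_coincidence_set c \<epsilon>" "0 < e"
  then show "\<exists>d y. 0 < d \<and> d < e \<and>
      ball y (\<epsilon> / (6 * (3 + 2 * \<epsilon>)) * d) \<subseteq> ball t d - (overlap_region c - near_coincidence_set c \<epsilon>)"
    using overlap_region_holes [OF c, of t \<epsilon> e] \<open>0 < \<epsilon>\<close> by blast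
qed

lemma AE_near_coincidences:
  assumes c: "0 < c" "c < 1 / 3"
  shows "AE t in lebesgue. t \<in> overlap_region c \<longrightarrow> near_coincidences c t"
proof -
  define S where "S = (\<Union>k. overlap_region c - near_coincidence_set c (1 / real (Suc k)))"
  have "negligible S"
    unfolding S_def using negligible_overlap_region_diff_near_coincidence_set [OF c]
    by (intro negligible_Union_nat) auto
  moreover have "near_coincidences c t" if "t \<in> overlap_region c" "t \<notin> S" for t
    unfolding near_coincidences_def
  proof (intro allI impI)
    fix \<epsilon> :: real assume "0 < \<epsilon>"
    then obtain k where k: "1 / real (Suc k) < \<epsilon>" using nat_approx_posE by blast
    have "t \<in> near_coincidence_set c (1 / real (Suc k))" using that by (auto simp: S_def)
    then obtain w v where wv: "length w = length v" "0 < word_point c t w - word_point c t v"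
        "word_point c t w - word_point c t v < 1 / real (Suc k) * c ^ length w"
      unfolding near_coincidence_set_def by blast
    moreover have "1 / real (Suc k) * c ^ length w \<le> \<epsilon> * c ^ length w"
      using k c by (intro mult_right_mono) auto
    ultimately have "word_point c t w - word_point c t v < \<epsilon> * c ^ length w" by linarith
    then show "t \<in> near_coincidence_set c \<epsilon>" using wv unfolding near_coincidence_set_def by blast
  qed
  ultimately show ?thesis
    unfolding eventually_ae_filter_negligible by blast
qed

lemma AE_meets_nonempty_open:
  fixes U :: "'a::euclidean_space set"
  assumes "AE x in lebesgue. P x" "open U" "U \<noteq> {}"
  obtains x where "x \<in> U" "P x"
  using assms open_not_negligible [of U] negligible_subset
  unfolding eventually_ae_filter_negligible by blast

theorem theorem2p9:
  fixes c s :: real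
  assumes "1 / 5 < c" and "c < 1 / 3"
    and "s = - ln 3 / ln c"
  shows "s < 1 \<and>
    (\<exists>U V :: (real ^ 3) set.
       open U \<and> open V \<and> U \<noteq> {} \<and> V \<noteq> {} \<and> U \<inter> V = {} \<and>
       (\<forall>t\<in>U. assouad_dim (attractor c t) = s) \<and>
       (AE t in lebesgue. t \<in> V \<longrightarrow> assouad_dim (attractor c t) = 1)) \<and>
    \<not> (\<exists>k. AE t :: real ^ 3 in lebesgue. assouad_dim (attractor c t) = k)"
proof -
  have c: "0 < c" "c < 1" "c < 1 / 3" using assms by auto
  define U where "U = separation_region c"
  define V where "V = overlap_region c"
  have "ln c < ln (1 / 3)" using c by (intro ln_less_cancel_iff [THEN iffD2]) auto
  then have lnc: "ln c < - ln 3" by (simp add: ln_div)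
  have "0 < ln (3 :: real)" by simp
  with lnc have "ln c < 0" by linarith
  have s: "s < 1" "0 \<le> s" "(1 / c) powr s = 3"
  proof -
    show "s < 1"
      using lnc unfolding assms(3) neg_divide_less_eq [OF \<open>ln c < 0\<close>] by simp
    show "0 \<le> s"
      unfolding assms(3) using \<open>0 < ln 3\<close> \<open>ln c < 0\<close> by (intro divide_nonpos_neg) auto
    have "s * ln (1 / c) = ln 3"
      using \<open>ln c < 0\<close> c by (simp add: assms(3) ln_div)
    then show "(1 / c) powr s = 3" using c by (simp add: powr_def)
  qed
  \<comment> \<open>Equally spaced translations separate the pieces because \<open>c < 1/3\<close>.\<close>
  have "(vector [0, 1 / 2, 1] :: real ^ 3) \<in> U"
    using c by (simp add: U_def separation_region_def)
  then have "U \<noteq> {}" by blast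
  \<comment> \<open>For \<open>w = 1/2\<close> and \<open>a = 1/8\<close> both conditions on the overlap region reduce to \<open>c > 1/5\<close>.\<close>
  have "(vector [0, 1 / 8, 1 / 2] :: real ^ 3) \<in> V"
    using assms by (simp add: V_def overlap_region_def)
  then have "V \<noteq> {}" by blast
  have "U \<inter> V = {}" by (auto simp: U_def V_def separation_region_def overlap_region_def)
  have U: "\<forall>t\<in>U. assouad_dim (attractor c t) = s"
    using assouad_dim_attractor_separated [OF c(1,2) s(2,3)] by (simp add: U_def)
  have near: "assouad_dim (attractor c t) = 1" if "near_coincidences c t" for t :: "real ^ 3"
  proof (rule antisym)
    show "assouad_dim (attractor c t) \<le> 1" by (rule assouad_dim_le [OF assouad_exponent_1])
    show "1 \<le> assouad_dim (attractor c t)"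
      by (rule assouad_dim_ge [OF assouad_exponent_near_coincidences
            [OF is_attractor_attractor [OF c(1,2)] c(1,2) that]])
  qed
  have V: "AE t in lebesgue. t \<in> V \<longrightarrow> assouad_dim (attractor c t) = 1"
    using AE_near_coincidences [OF c(1,3)] near unfolding V_def by (auto elim: eventually_mono)
  have opens: "open U" "open V"
    by (simp_all add: U_def V_def open_separation_region open_overlap_region)
  have "\<not> (AE t :: real ^ 3 in lebesgue. assouad_dim (attractor c t) = k)" for k
  proof
    assume k: "AE t :: real ^ 3 in lebesgue. assouad_dim (attractor c t) = k"
    obtain t where "t \<in> U" "assouad_dim (attractor c t) = k"
      using AE_meets_nonempty_open [OF k \<open>open U\<close> \<open>U \<noteq> {}\<close>] .
    then have "k = s" using U by auto
    have "AE t in lebesgue. t \<in> V \<longrightarrow> k = 1"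
      using k V by eventually_elim auto
    then obtain t where "t \<in> V" "t \<in> V \<longrightarrow> k = 1"
      using AE_meets_nonempty_open \<open>open V\<close> \<open>V \<noteq> {}\<close> by blast
    then show False using \<open>k = s\<close> \<open>s < 1\<close> by simp
  qed
  then show ?thesis
    using s U V opens \<open>U \<noteq> {}\<close> \<open>V \<noteq> {}\<close> \<open>U \<inter> V = {}\<close> by blast
qed

end
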